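(* Assume all thermal noise is zero ($\mathbf N_T=\mathbf 0$, $\mathbf N_D=\mathbf 0$). If the jammer is not eclipsed (in the sense of eclipsing with channel estimation defined in the context), then every minimizer $(\hat{\mathbf P},\hat{\mathbf H},\hat{\mathbf S}_D)$ of $$\min_{\tilde{\mathbf P}\in\mathscr G_{B-I}(\mathbb C^B),\ \tilde{\mathbf H}\in\mathbb C^{B\times U},\ \tilde{\mathbf S}_D\in\mathcal S^{U\times D}}\ \big\|\tilde{\mathbf P}\big([\mathbf Y_T,\mathbf Y_D]-\tilde{\mathbf H}[\mathbf S_T,\tilde{\mathbf S}_D]\big)\big\|_F^2$$ satisfies $\hat{\mathbf P}=\mathbf I_B-\mathbf J\mathbf J^\dagger$, $\hat{\mathbf P}\hat{\mathbf H}=\hat{\mathbf P}\mathbf H$, and $\hat{\mathbf S}_D=\mathbf S_D$ (and such minimizers exist).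
   Context: Let $B,U,I,T,D$ be positive integers with $B\ge U+I$ and $T\ge U$. Let $\mathcal S=\{(\pm1\pm i)/\sqrt2\}\subset\mathbb C$ (QPSK). Let $\mathbf H\in\mathbb C^{B\times U}$, $\mathbf J\in\mathbb C^{B\times I}$ with $[\mathbf H,\mathbf J]$ of full column rank $U+I$. Let $\mathbf S_T\in\mathbb C^{U\times T}$ be a pilot matrix of full row rank $U$, $\mathbf S_D\in\mathcal S^{U\times D}$, $\mathbf W_T\in\mathbb C^{I\times T}$, $\mathbf W_D\in\mathbb C^{I\times D}$, noise $\mathbf N_T,\mathbf N_D$, and $\mathbf Y_T=\mathbf H\mathbf S_T+\mathbf J\mathbf W_T+\mathbf N_T$, $\mathbf Y_D=\mathbf H\mathbf S_D+\mathbf J\mathbf W_D+\mathbf N_D$; $[\mathbf A,\mathbf B]$ is horizontal concatenation. $\mathbf A^\dagger$ is the Moore–Penrose pseudoinverse. $\mathscr G_{B-I}(\mathbb C^B)$ denotes the set of $B\times B$ orthogonal projections onto $(B-I)$-dimensional subspaces of $\mathbb C^B$. Eclipsing with channel estimation: the jammer is eclipsed if there exists $\tilde{\mathbf S}_D\in\mathcal S^{U\times D}\setminus\{\mathbf S_D\}$ such that $\begin{bmatrix}\mathbf S_D-\tilde{\mathbf S}_D\\ \mathbf W_D-\mathbf W_T\mathbf S_T^\dagger\tilde{\mathbf S}_D\end{bmatrix}$ has rank at most $I$. *)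

theory Defs
  imports "Jordan_Normal_Form.Schur_Decomposition" "Jordan_Normal_Form.DL_Rank"
begin

text \<open>Rank of a matrix (dimension of its column space).\<close>
definition mrank :: "complex mat \<Rightarrow> nat" where
  "mrank A = vec_space.rank (dim_row A) A"

text \<open>Horizontal concatenation [A, B].\<close>
definition append_cols :: "complex mat \<Rightarrow> complex mat \<Rightarrow> complex mat" where
  "append_cols A B = four_block_mat A B (0\<^sub>m 0 (dim_col A)) (0\<^sub>m 0 (dim_col B))"

text \<open>Moore--Penrose pseudoinverse: the unique matrix satisfying the Penrose conditions.\<close>
definition pinv :: "complex mat \<Rightarrow> complex mat" where
  "pinv A = (THE X. X \<in> carrier_mat (dim_col A) (dim_row A) \<and>
      A * X * A = A \<and> X * A * X = X \<and>
      mat_adjoint (A * X) = A * X \<and> mat_adjoint (X * A) = X * A)"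

text \<open>QPSK constellation {(+-1 +- i)/sqrt 2}.\<close>
definition qpsk :: "complex set" where
  "qpsk = {(complex_of_real a + \<i> * complex_of_real b) / complex_of_real (sqrt 2) | a b.
            a \<in> {-1, 1} \<and> b \<in> {-1, 1}}"

definition qpsk_mats :: "nat \<Rightarrow> nat \<Rightarrow> complex mat set" where
  "qpsk_mats m n = {S \<in> carrier_mat m n. \<forall>i<m. \<forall>j<n. S $$ (i, j) \<in> qpsk}"

text \<open>Squared Frobenius norm.\<close>
definition frob_sq :: "complex mat \<Rightarrow> real" where
  "frob_sq A = (\<Sum>i<dim_row A. \<Sum>j<dim_col A. (cmod (A $$ (i, j)))\<^sup>2)"

text \<open>Orthogonal projections of C^n onto k-dimensional subspaces (the Grassmannian G_k(C^n)).\<close>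
definition orth_projs :: "nat \<Rightarrow> nat \<Rightarrow> complex mat set" where
  "orth_projs n k = {P \<in> carrier_mat n n. P * P = P \<and> mat_adjoint P = P \<and> mrank P = k}"

text \<open>Eclipsing with channel estimation.\<close>
definition eclipsed_ce :: "nat \<Rightarrow> nat \<Rightarrow> nat \<Rightarrow> complex mat \<Rightarrow> complex mat \<Rightarrow> complex mat \<Rightarrow> complex mat \<Rightarrow> bool" where
  "eclipsed_ce U D I S_T S_D W_T W_D =
    (\<exists>St \<in> qpsk_mats U D. St \<noteq> S_D \<and>
       mrank ((S_D - St) @\<^sub>r (W_D - W_T * pinv S_T * St)) \<le> I)"

text \<open>Objective of the joint estimation problem.\<close>
definition jml_cost :: "complex mat \<Rightarrow> complex mat \<Rightarrow> complex mat \<Rightarrow> complex mat \<Rightarrow> complex mat \<Rightarrow> complex mat \<Rightarrow> real" where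
  "jml_cost Y_T Y_D S_T P Ht St = frob_sq (P * (append_cols Y_T Y_D - Ht * append_cols S_T St))"

definition is_jml_minimizer ::
  "nat \<Rightarrow> nat \<Rightarrow> nat \<Rightarrow> nat \<Rightarrow> complex mat \<Rightarrow> complex mat \<Rightarrow> complex mat \<Rightarrow> complex mat \<Rightarrow> complex mat \<Rightarrow> complex mat \<Rightarrow> bool" where
  "is_jml_minimizer B U I D Y_T Y_D S_T P Ht St =
    (P \<in> orth_projs B (B - I) \<and> Ht \<in> carrier_mat B U \<and> St \<in> qpsk_mats U D \<and>
     (\<forall>P' \<in> orth_projs B (B - I). \<forall>H' \<in> carrier_mat B U. \<forall>S' \<in> qpsk_mats U D.
        jml_cost Y_T Y_D S_T P Ht St \<le> jml_cost Y_T Y_D S_T P' H' S'))"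

end

(*
  Without noise the objective is a sum of two squared Frobenius norms, and it vanishes at the
  true parameters (I - J J^+, H, S_D); hence the minimizers are exactly the feasible points of
  cost zero.  At such a point the training block gives P Ht = P H + P J K with K = W_T S_T^+
  (S_T has full row rank, so S_T S_T^+ = I), and the data block then says that P annihilates
  [H, J] M with M = [S_D - St; W_D - K St].  The kernel of P has dimension I and [H, J] is
  injective, so rank M <= I, and since the jammer is not eclipsed, St = S_D.  Now M = [0; X]
  with X = W_D - K S_D, so (P J) X = 0.  A nonzero R with R X = 0 forces rank X < I, and
  flipping the sign of one QPSK symbol of S_D changes M only by a rank-one term; this would
  eclipse the jammer, so P J = 0.  Finally, an orthogonal projection of rank B - I that kills
  the I independent columns of J is I - J J^+, and P J = 0 turns P Ht = P H + P J K into
  P Ht = P H.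
*)

theory Submission
  imports Defs "Jordan_Normal_Form.Matrix_Kernel"
begin

section \<open>Rank, kernel and injectivity of matrices\<close>

lemma mult_mat_vec_zero [simp]:
  "A \<in> carrier_mat nr nc \<Longrightarrow> A *\<^sub>v 0\<^sub>v nc = (0\<^sub>v nr :: 'a :: semiring_0 vec)"
  by (rule eq_vecI) (auto simp: scalar_prod_def)

lemma minus_zero_mat [simp]:
  "A \<in> carrier_mat nr nc \<Longrightarrow> A - 0\<^sub>m nr nc = (A :: 'a :: group_add mat)"
  by (rule eq_matI) auto

lemma mat_minus_eq_0_iff:
  fixes A B :: "'a :: ab_group_add mat"
  assumes "A \<in> carrier_mat n m" "B \<in> carrier_mat n m"
  shows "A - B = 0\<^sub>m n m \<longleftrightarrow> A = B"
proof
  assume "A - B = 0\<^sub>m n m"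
  then have "\<And>i j. i < n \<Longrightarrow> j < m \<Longrightarrow> A $$ (i, j) - B $$ (i, j) = 0"
    using assms by (metis index_minus_mat(1) index_zero_mat(1) carrier_matD)
  then show "A = B" using assms by (intro eq_matI) auto
qed (use assms in auto)

lemma inj_on_mult_mat_vec_iff:
  fixes A :: "'a :: comm_ring_1 mat"
  assumes A: "A \<in> carrier_mat n m"
  shows "inj_on ((*\<^sub>v) A) (carrier_vec m) \<longleftrightarrow>
    (\<forall>v \<in> carrier_vec m. A *\<^sub>v v = 0\<^sub>v n \<longrightarrow> v = 0\<^sub>v m)"
proof
  assume "inj_on ((*\<^sub>v) A) (carrier_vec m)"
  then show "\<forall>v \<in> carrier_vec m. A *\<^sub>v v = 0\<^sub>v n \<longrightarrow> v = 0\<^sub>v m"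
    using A by (auto dest: inj_onD[of _ _ _ "0\<^sub>v m"])
next
  assume ker: "\<forall>v \<in> carrier_vec m. A *\<^sub>v v = 0\<^sub>v n \<longrightarrow> v = 0\<^sub>v m"
  show "inj_on ((*\<^sub>v) A) (carrier_vec m)"
  proof (rule inj_onI)
    fix v w assume v: "v \<in> carrier_vec m" and w: "w \<in> carrier_vec m" and eq: "A *\<^sub>v v = A *\<^sub>v w"
    have "A *\<^sub>v (v - w) = 0\<^sub>v n" using mult_minus_distrib_mat_vec[OF A v w] eq A w by simp
    then have "v - w = 0\<^sub>v m" using ker v w by simp
    moreover have "v = (v - w) + w" using v w by (intro eq_vecI) auto
    ultimately show "v = w" using w by simp
  qed
qed

lemma inj_on_one_mat: "inj_on ((*\<^sub>v) (1\<^sub>m n :: 'a :: semiring_1 mat)) (carrier_vec n)"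
  by (auto simp: inj_on_def)

lemma mult_mat_vec_linear_map:
  fixes A :: "'a :: field mat"
  assumes A: "A \<in> carrier_mat nr nc"
  shows "linear_map class_ring (module_vec TYPE('a) nc) (module_vec TYPE('a) nr) (\<lambda>x. A *\<^sub>v x)"
proof -
  interpret NC: vec_space "TYPE('a)" nc .
  interpret NR: vec_space "TYPE('a)" nr .
  show ?thesis
    by unfold_locales
      (use A in \<open>auto simp: LinearCombinations.module_hom_def mult_add_distrib_mat_vec
        mult_mat_vec module_vec_simps class_ring_simps\<close>)
qed

lemma rank_nullity:
  fixes A :: "'a :: field mat"
  assumes A: "A \<in> carrier_mat nr nc"
  shows "vec_space.rank nr A + kernel_dim A = nc"
proof -
  interpret K: kernel nr nc A by (unfold_locales) (rule A)
  interpret NR: vec_space "TYPE('a)" nr .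
  interpret L: linear_map class_ring "module_vec TYPE('a) nc" "module_vec TYPE('a) nr" "\<lambda>x. A *\<^sub>v x"
    by (rule mult_mat_vec_linear_map[OF A])
  have im: "L.imT = NR.col_space A"
    unfolding NR.col_space_eq[OF A] mod_hom.im_def[OF L.mod_hom_axioms] using A
    by (auto simp: module_vec_simps)
  have ker: "L.kerT = mat_kernel A"
    unfolding mat_kernel_def mod_hom.ker_def[OF L.mod_hom_axioms] using A
    by (auto simp: module_vec_simps)
  have "vectorspace.dim class_ring ((module_vec TYPE('a) nr)\<lparr>carrier := L.imT\<rparr>) +
      vectorspace.dim class_ring ((module_vec TYPE('a) nc)\<lparr>carrier := L.kerT\<rparr>) = nc"
    using L.rank_nullity K.NC.dim_is_n K.NC.fin_dim by simp
  then show ?thesis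
    unfolding im ker NR.rank_def NR.col_space_def using A by simp
qed

lemma mat_kernel_in_range:
  fixes A :: "'a :: field mat"
  assumes A: "A \<in> carrier_mat nr nc"
  obtains Q where "Q \<in> carrier_mat nc (kernel_dim A)"
    and "\<And>x. x \<in> mat_kernel A \<Longrightarrow> \<exists>c \<in> carrier_vec (kernel_dim A). x = Q *\<^sub>v c"
proof -
  interpret K: kernel nr nc A by (unfold_locales) (rule A)
  obtain B where finB: "finite B" and bas: "K.basis B" using kernel_basis_exists[OF A] by blast
  have BK: "B \<subseteq> mat_kernel A" and gen: "K.span B = mat_kernel A"
    using bas unfolding K.Ker.basis_def by auto
  obtain ws where ws: "set ws = B" "distinct ws" using finite_distinct_list[OF finB] by blast
  have len: "length ws = kernel_dim A"
    using ws K.Ker.dim_basis[OF finB bas] distinct_card by fastforce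
  have wsc: "set ws \<subseteq> carrier_vec nc" using ws BK A unfolding mat_kernel_def by auto
  have "submodule class_ring (mat_kernel A) K.NC.V"
    by unfold_locales
      (use A mult_add_distrib_mat_vec[OF A] mult_mat_vec[OF A] mat_kernel[OF A] in
        \<open>auto simp: class_ring_simps\<close>)
  then have "K.NC.span B = mat_kernel A"
    using K.NC.span_li_not_depend(1)[OF BK] gen by simp
  then have cs: "K.NC.col_space (mat_of_cols nc ws) = mat_kernel A"
    unfolding K.NC.col_space_def cols_mat_of_cols[OF wsc] ws(1) .
  show ?thesis
  proof (rule that)
    show "mat_of_cols nc ws \<in> carrier_mat nc (kernel_dim A)"
      using mat_of_cols_carrier(1)[of nc ws] unfolding len .
    fix x assume "x \<in> mat_kernel A"
    then show "\<exists>c \<in> carrier_vec (kernel_dim A). x = mat_of_cols nc ws *\<^sub>v c"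
      using cs len by (force simp: K.NC.col_space_eq[OF mat_of_cols_carrier(1)])
  qed
qed

lemma kernel_dim_eq_0_iff:
  fixes A :: "'a :: field mat"
  assumes A: "A \<in> carrier_mat nr nc"
  shows "kernel_dim A = 0 \<longleftrightarrow> mat_kernel A = {0\<^sub>v nc}"
proof
  assume dim0: "kernel_dim A = 0"
  obtain Q where Q: "Q \<in> carrier_mat nc 0"
    and range: "\<And>x. x \<in> mat_kernel A \<Longrightarrow> \<exists>c \<in> carrier_vec 0. x = Q *\<^sub>v c"
    using mat_kernel_in_range[OF A] unfolding dim0 by blast
  have "x = 0\<^sub>v nc" if "x \<in> mat_kernel A" for x
    using range[OF that] Q by (auto simp: scalar_prod_def)
  then show "mat_kernel A = {0\<^sub>v nc}" using A by (auto simp: mat_kernel_def)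
next
  interpret K: kernel nr nc A by (unfold_locales) (rule A)
  assume "mat_kernel A = {0\<^sub>v nc}"
  then have "K.gen_set {0\<^sub>v nc}"
    using K.Ker.span_zero K.Ker.span_is_subset2[of "{0\<^sub>v nc}"] by auto
  then show "kernel_dim A = 0" using K.Ker.dim0I by simp
qed

lemma rank_eq_dim_col_iff_inj:
  fixes A :: "'a :: field mat"
  assumes A: "A \<in> carrier_mat nr nc"
  shows "vec_space.rank nr A = nc \<longleftrightarrow> inj_on ((*\<^sub>v) A) (carrier_vec nc)"
proof -
  have "vec_space.rank nr A = nc \<longleftrightarrow> kernel_dim A = 0" using rank_nullity[OF A] by auto
  moreover have "mat_kernel A = {0\<^sub>v nc} \<longleftrightarrow>
      (\<forall>v \<in> carrier_vec nc. A *\<^sub>v v = 0\<^sub>v nr \<longrightarrow> v = 0\<^sub>v nc)"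
    using A by (auto simp: mat_kernel_def)
  ultimately show ?thesis using kernel_dim_eq_0_iff[OF A] inj_on_mult_mat_vec_iff[OF A] by simp
qed

lemma rank_le_of_cols_in_range:
  fixes A C :: "'a :: field mat"
  assumes A: "A \<in> carrier_mat n a" and C: "C \<in> carrier_mat n c"
    and cols: "\<And>j. j < a \<Longrightarrow> \<exists>y \<in> carrier_vec c. col A j = C *\<^sub>v y"
  shows "vec_space.rank n A \<le> c"
proof -
  interpret V: vec_space "TYPE('a)" n .
  let ?S = "set (cols C)"
  have Sc: "?S \<subseteq> carrier_vec n" using C cols_dim by blast
  have sub: "set (cols A) \<subseteq> V.span ?S"
  proof
    fix v assume "v \<in> set (cols A)"
    then obtain j where j: "j < a" "v = col A j"
      using A by (metis carrier_matD(2) cols_length cols_nth in_set_conv_nth)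
    obtain y where y: "y \<in> carrier_vec c" "col A j = C *\<^sub>v y" using cols[OF j(1)] by blast
    have "C *\<^sub>v y \<in> V.col_space C" unfolding V.col_space_eq[OF C] using C y by auto
    then show "v \<in> V.span ?S" using j y unfolding V.col_space_def by simp
  qed
  have vs: "vectorspace class_ring (V.vs (V.span ?S))"
    using V.span_is_subspace[THEN V.subspace_is_vs, OF Sc] by auto
  have subm: "submodule class_ring (V.span ?S) V.V" by (simp add: V.span_is_submodule Sc)
  have "VectorSpace.subspace class_ring (V.span (set (cols A))) (V.vs (V.span ?S))"
    using vectorspace.span_is_subspace[OF vs, of "set (cols A)",
        unfolded V.span_li_not_depend(1)[OF sub subm]] sub by auto
  moreover have "vectorspace.fin_dim class_ring (V.vs (V.span ?S))"
    "vectorspace.fin_dim class_ring (V.vs (V.span ?S)\<lparr>carrier := V.span (set (cols A))\<rparr>)"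
    using V.fin_dim_span_cols A C by auto
  ultimately have "V.rank A \<le> V.rank C" unfolding V.rank_def
    using vectorspace.subspace_dim[OF vs] by simp
  also have "\<dots> \<le> c" using V.rank_le_nc[OF C] .
  finally show ?thesis .
qed

lemma rank_mult_eq_zero:
  fixes R A :: "'a :: field mat"
  assumes R: "R \<in> carrier_mat nr n" and A: "A \<in> carrier_mat n nc"
    and RA: "R * A = 0\<^sub>m nr nc"
  shows "vec_space.rank n A + vec_space.rank nr R \<le> n"
proof -
  obtain Q where Q: "Q \<in> carrier_mat n (kernel_dim R)"
    and range: "\<And>x. x \<in> mat_kernel R \<Longrightarrow> \<exists>c \<in> carrier_vec (kernel_dim R). x = Q *\<^sub>v c"
    using mat_kernel_in_range[OF R] by blast
  have "vec_space.rank n A \<le> kernel_dim R"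
  proof (rule rank_le_of_cols_in_range[OF A Q])
    fix j assume j: "j < nc"
    have "R *\<^sub>v col A j = col (R * A) j" by (rule col_mult2[OF R A j, symmetric])
    then have "col A j \<in> mat_kernel R" using RA A j by (auto intro: mat_kernelI[OF R])
    then show "\<exists>c \<in> carrier_vec (kernel_dim R). col A j = Q *\<^sub>v c" by (rule range)
  qed
  then show ?thesis using rank_nullity[OF R] by simp
qed

lemma rank_pos:
  fixes A :: "'a :: field mat"
  assumes A: "A \<in> carrier_mat n m" and nz: "A \<noteq> 0\<^sub>m n m"
  shows "0 < vec_space.rank n A"
proof -
  interpret V: vec_space "TYPE('a)" n .
  obtain i j where ij: "i < n" "j < m" "A $$ (i, j) \<noteq> 0"
    using nz A by (metis eq_matI carrier_matD index_zero_mat)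
  let ?v = "col A j"
  have vc: "?v \<in> carrier_vec n" using A ij by auto
  have "V.lin_indpt {?v}"
  proof (rule V.finite_lin_indpt2)
    fix a assume "V.lincomb a {?v} = 0\<^sub>v n"
    then have "a ?v * ?v $ i = 0" using V.lincomb_index[OF ij(1), of "{?v}" a] vc ij by simp
    then show "\<forall>v\<in>{?v}. a v = 0" using ij A by (simp add: class_ring_simps)
  qed (use vc in auto)
  moreover have "{?v} \<subseteq> set (cols A)" using A ij by (simp add: cols_def)
  ultimately have "card {?v} \<le> V.rank A" using V.rank_ge_card_indpt[OF A] by blast
  then show ?thesis by simp
qed

lemma rank_one_mat: "vec_space.rank n (1\<^sub>m n :: 'a :: field mat) = n"
proof -
  have "kernel_dim (1\<^sub>m n :: 'a mat) = 0"
    unfolding kernel_dim_def using kernel_one_mat(1)[where 'a = 'a, of n] by simp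
  then show ?thesis using rank_nullity[of "1\<^sub>m n :: 'a mat" n n] by simp
qed

lemma rank_mult_inj_left:
  fixes C M :: "'a :: field mat"
  assumes C: "C \<in> carrier_mat n k" and M: "M \<in> carrier_mat k a"
    and inj: "inj_on ((*\<^sub>v) C) (carrier_vec k)"
  shows "vec_space.rank n (C * M) = vec_space.rank k M"
proof -
  have "mat_kernel (C * M) = mat_kernel M"
  proof (intro equalityI subsetI)
    fix v assume "v \<in> mat_kernel (C * M)"
    then have v: "v \<in> carrier_vec a" and "C *\<^sub>v (M *\<^sub>v v) = 0\<^sub>v n"
      using C M by (auto simp: mat_kernel_def)
    then show "v \<in> mat_kernel M"
      using inj M unfolding inj_on_mult_mat_vec_iff[OF C] by (auto simp: mat_kernel_def)
  qed (use mat_kernel_mult_subset[OF M C] in auto)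
  then have "kernel_dim (C * M) = kernel_dim M" using C M unfolding kernel_dim_def by simp
  then show ?thesis using rank_nullity[OF mult_carrier_mat[OF C M]] rank_nullity[OF M] by simp
qed

lemma mat_factor_through_range:
  fixes A C :: "'a :: field mat"
  assumes A: "A \<in> carrier_mat n a" and C: "C \<in> carrier_mat n c"
    and cols: "\<And>j. j < a \<Longrightarrow> \<exists>y \<in> carrier_vec c. col A j = C *\<^sub>v y"
  obtains Y where "Y \<in> carrier_mat c a" "A = C * Y"
proof -
  define y where "y j = (SOME y. y \<in> carrier_vec c \<and> col A j = C *\<^sub>v y)" for j
  have y: "y j \<in> carrier_vec c" "col A j = C *\<^sub>v y j" if "j < a" for j
    using someI_ex[OF cols[OF that, unfolded Bex_def]] unfolding y_def by auto
  define Y where "Y = mat_of_cols c (map y [0..<a])"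
  have Y: "Y \<in> carrier_mat c a" unfolding Y_def using mat_of_cols_carrier(1)[of c "map y [0..<a]"] by simp
  have "A = C * Y"
  proof (rule mat_col_eqI)
    fix j assume "j < dim_col (C * Y)"
    then have j: "j < a" using Y by simp
    have "col Y j = y j" unfolding Y_def using j y(1)[OF j] by (auto simp: mat_of_cols_def)
    then show "col A j = col (C * Y) j" using y(2)[OF j] col_mult2[OF C Y j] by simp
  qed (use A C Y in auto)
  with Y that show ?thesis by blast
qed

lemma inj_square_mat_invertible:
  fixes A :: "'a :: field mat"
  assumes A: "A \<in> carrier_mat n n"
    and inj: "inj_on ((*\<^sub>v) A) (carrier_vec n)"
  obtains N where "N \<in> carrier_mat n n" "A * N = 1\<^sub>m n" "N * A = 1\<^sub>m n"
proof -
  have "det A \<noteq> 0"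
    using det_0_iff_vec_prod_zero_field[OF A] inj unfolding inj_on_mult_mat_vec_iff[OF A] by blast
  from det_non_zero_imp_unit[OF A this, of "()"] that show ?thesis
    unfolding Units_def by (auto simp: ring_mat_simps)
qed

lemma mat_kernel_in_range_of_mult_zero:
  fixes P J :: "'a :: field mat"
  assumes P: "P \<in> carrier_mat nr n" and J: "J \<in> carrier_mat n m"
    and rank: "vec_space.rank nr P + m = n" and PJ: "P * J = 0\<^sub>m nr m"
    and inj: "inj_on ((*\<^sub>v) J) (carrier_vec m)" and x: "x \<in> mat_kernel P"
  shows "\<exists>c \<in> carrier_vec m. x = J *\<^sub>v c"
proof -
  have dim: "kernel_dim P = m" using rank_nullity[OF P] rank by simp
  obtain Q where Q: "Q \<in> carrier_mat n m"
    and range: "\<And>x. x \<in> mat_kernel P \<Longrightarrow> \<exists>c \<in> carrier_vec m. x = Q *\<^sub>v c"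
    using mat_kernel_in_range[OF P] unfolding dim by blast
  have "\<exists>y \<in> carrier_vec m. col J j = Q *\<^sub>v y" if j: "j < m" for j
  proof (rule range)
    show "col J j \<in> mat_kernel P"
      using P J j col_mult2[OF P J j] PJ by (auto intro: mat_kernelI)
  qed
  then obtain Y where Y: "Y \<in> carrier_mat m m" and JQY: "J = Q * Y"
    using mat_factor_through_range[OF J Q] by blast
  have "inj_on ((*\<^sub>v) Q \<circ> (*\<^sub>v) Y) (carrier_vec m)"
    using inj JQY Q Y by (auto simp: inj_on_def)
  then obtain N where N: "N \<in> carrier_mat m m" and YN: "Y * N = 1\<^sub>m m"
    using inj_square_mat_invertible[OF Y inj_on_imageI2] by blast
  have QJN: "Q = J * N" using JQY Q Y N YN by (simp add: assoc_mult_mat)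
  obtain c where c: "c \<in> carrier_vec m" "x = Q *\<^sub>v c" using range[OF x] by blast
  then show ?thesis using QJN J N by (intro bexI[of _ "N *\<^sub>v c"]) (auto simp: assoc_mult_mat_vec)
qed

section \<open>Block matrices and the Frobenius norm\<close>

lemma append_rows_dim [simp]:
  "dim_row (A @\<^sub>r B) = dim_row A + dim_row B" "dim_col (A @\<^sub>r B) = dim_col A"
  unfolding append_rows_def by auto

lemma append_rows_index:
  assumes "A \<in> carrier_mat n1 m" "B \<in> carrier_mat n2 m" "i < n1 + n2" "j < m"
  shows "(A @\<^sub>r B) $$ (i, j) = (if i < n1 then A $$ (i, j) else B $$ (i - n1, j))"
  using assms unfolding append_rows_def by auto

lemma mult_append_rows:
  fixes A B C :: "'a :: comm_ring_1 mat"
  assumes A: "A \<in> carrier_mat n1 k" and B: "B \<in> carrier_mat n2 k" and C: "C \<in> carrier_mat k m"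
  shows "(A @\<^sub>r B) * C = (A * C) @\<^sub>r (B * C)"
proof (rule eq_matI)
  fix i j assume "i < dim_row ((A * C) @\<^sub>r (B * C))" "j < dim_col ((A * C) @\<^sub>r (B * C))"
  then have ij: "i < n1 + n2" "j < m"
    using carrier_append_rows[OF mult_carrier_mat[OF A C] mult_carrier_mat[OF B C]] by auto
  have "row (A @\<^sub>r B) i = (if i < n1 then row A i else row B (i - n1))"
    using A B ij by (intro eq_vecI) (auto simp: append_rows_index)
  then show "((A @\<^sub>r B) * C) $$ (i, j) = ((A * C) @\<^sub>r (B * C)) $$ (i, j)"
    using ij A B C by (simp add: append_rows_index[of "A * C" n1 m "B * C" n2])
qed (use A B C in auto)

lemma add_append_rows:
  fixes A B C D :: "'a :: monoid_add mat"
  assumes "A \<in> carrier_mat n1 m" "B \<in> carrier_mat n2 m" "C \<in> carrier_mat n1 m" "D \<in> carrier_mat n2 m"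
  shows "(A @\<^sub>r B) + (C @\<^sub>r D) = (A + C) @\<^sub>r (B + D)"
  using assms by (intro eq_matI) (auto simp: append_rows_index[of _ n1 m _ n2])

lemma inj_on_append_rows:
  fixes A B :: "'a :: field mat"
  assumes A: "A \<in> carrier_mat n1 m" and B: "B \<in> carrier_mat n2 m"
    and inj: "inj_on ((*\<^sub>v) A) (carrier_vec m) \<or> inj_on ((*\<^sub>v) B) (carrier_vec m)"
  shows "inj_on ((*\<^sub>v) (A @\<^sub>r B)) (carrier_vec m)"
proof (rule inj_onI)
  fix v w assume v: "v \<in> carrier_vec m" and w: "w \<in> carrier_vec m"
    and eq: "(A @\<^sub>r B) *\<^sub>v v = (A @\<^sub>r B) *\<^sub>v w"
  then have "A *\<^sub>v v = A *\<^sub>v w \<and> B *\<^sub>v v = B *\<^sub>v w"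
    using mat_mult_append[OF A B v] mat_mult_append[OF A B w] append_vec_eq[of "A *\<^sub>v v" n1 "A *\<^sub>v w"]
      mult_mat_vec_carrier[OF A v] mult_mat_vec_carrier[OF A w] by simp
  then show "v = w" using inj v w by (auto dest: inj_onD)
qed

lemma rank_append_rows_mult_add_le:
  fixes A K X :: "'a :: field mat"
  assumes A: "A \<in> carrier_mat u d" and K: "K \<in> carrier_mat k u" and X: "X \<in> carrier_mat k d"
  shows "vec_space.rank (u + k) (A @\<^sub>r (K * A + X)) \<le> vec_space.rank u A + vec_space.rank k X"
proof -
  define F where "F = (1\<^sub>m u :: 'a mat) @\<^sub>r K"
  define E where "E = (0\<^sub>m u k :: 'a mat) @\<^sub>r 1\<^sub>m k"
  have F: "F \<in> carrier_mat (u + k) u" and E: "E \<in> carrier_mat (u + k) k"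
    unfolding F_def E_def using K by auto
  have "A @\<^sub>r (K * A + X) = F * A + E * X"
    unfolding F_def E_def
    using mult_append_rows[OF one_carrier_mat K A] mult_append_rows[OF zero_carrier_mat one_carrier_mat X]
      add_append_rows[of A u d "K * A" k "0\<^sub>m u d" X] K A X by simp
  moreover have "vec_space.rank (u + k) (F * A) = vec_space.rank u A"
    unfolding F_def
    by (rule rank_mult_inj_left[OF F[unfolded F_def] A inj_on_append_rows[OF one_carrier_mat K]])
      (simp add: inj_on_one_mat)
  moreover have "vec_space.rank (u + k) (E * X) = vec_space.rank k X"
    unfolding E_def
    by (rule rank_mult_inj_left[OF E[unfolded E_def] X inj_on_append_rows[OF zero_carrier_mat one_carrier_mat]])
      (simp add: inj_on_one_mat)
  ultimately show ?thesis
    using vec_space.rank_subadditive[OF mult_carrier_mat[OF F A] mult_carrier_mat[OF E X]] by simp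
qed

lemma append_cols_dim [simp]:
  "dim_row (append_cols A B) = dim_row A" "dim_col (append_cols A B) = dim_col A + dim_col B"
  unfolding append_cols_def by auto

lemma append_cols_carrier [simp]:
  "A \<in> carrier_mat n a \<Longrightarrow> B \<in> carrier_mat n b \<Longrightarrow> append_cols A B \<in> carrier_mat n (a + b)"
  by (intro carrier_matI) auto

lemma append_cols_index:
  assumes "A \<in> carrier_mat n a" "B \<in> carrier_mat n b" "i < n" "j < a + b"
  shows "append_cols A B $$ (i, j) = (if j < a then A $$ (i, j) else B $$ (i, j - a))"
  using assms unfolding append_cols_def by auto

lemma mult_append_cols:
  assumes M: "M \<in> carrier_mat m n" and A: "A \<in> carrier_mat n a" and B: "B \<in> carrier_mat n b"
  shows "M * append_cols A B = append_cols (M * A) (M * B)"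
proof (rule eq_matI)
  fix i j assume "i < dim_row (append_cols (M * A) (M * B))" "j < dim_col (append_cols (M * A) (M * B))"
  then have ij: "i < m" "j < a + b"
    using append_cols_carrier[OF mult_carrier_mat[OF M A] mult_carrier_mat[OF M B]] by auto
  have "col (append_cols A B) j = (if j < a then col A j else col B (j - a))"
    using A B ij by (intro eq_vecI) (auto simp: append_cols_index)
  then show "(M * append_cols A B) $$ (i, j) = append_cols (M * A) (M * B) $$ (i, j)"
    using ij M A B by (simp add: append_cols_index[of "M * A" m a "M * B" b])
qed (use M A B in auto)

lemma append_cols_minus:
  assumes "A \<in> carrier_mat n a" "B \<in> carrier_mat n b" "C \<in> carrier_mat n a" "D \<in> carrier_mat n b"
  shows "append_cols A B - append_cols C D = append_cols (A - C) (B - D)"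
  using assms by (intro eq_matI) (auto simp: append_cols_index[of _ n a _ b] minus_carrier_mat)

lemma append_cols_mult_append_rows:
  assumes H: "H \<in> carrier_mat n u" and J: "J \<in> carrier_mat n k"
    and A: "A \<in> carrier_mat u d" and B: "B \<in> carrier_mat k d"
  shows "append_cols H J * (A @\<^sub>r B) = H * A + J * B"
proof -
  have "append_cols H J * (A @\<^sub>r B) =
      four_block_mat H J (0\<^sub>m 0 u) (0\<^sub>m 0 k) * four_block_mat A (0\<^sub>m u 0) B (0\<^sub>m k 0)"
    unfolding append_cols_def append_rows_def using H J A B by simp
  also have "\<dots> = four_block_mat (H * A + J * B) (H * 0\<^sub>m u 0 + J * 0\<^sub>m k 0)
      (0\<^sub>m 0 u * A + 0\<^sub>m 0 k * B) (0\<^sub>m 0 u * 0\<^sub>m u 0 + 0\<^sub>m 0 k * 0\<^sub>m k 0)"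
    by (rule mult_four_block_mat[OF H J _ _ A _ B]) auto
  also have "\<dots> = H * A + J * B" using H J A B by (intro eq_matI) auto
  finally show ?thesis .
qed

lemma inj_on_append_cols_right:
  fixes H J :: "complex mat"
  assumes H: "H \<in> carrier_mat n u" and J: "J \<in> carrier_mat n k"
    and inj: "inj_on ((*\<^sub>v) (append_cols H J)) (carrier_vec (u + k))"
  shows "inj_on ((*\<^sub>v) J) (carrier_vec k)"
proof -
  define E where "E = (0\<^sub>m u k :: complex mat) @\<^sub>r 1\<^sub>m k"
  have E: "E \<in> carrier_mat (u + k) k" unfolding E_def by auto
  have E_inj: "inj_on ((*\<^sub>v) E) (carrier_vec k)"
    unfolding E_def by (rule inj_on_append_rows[OF zero_carrier_mat one_carrier_mat]) (simp add: inj_on_one_mat)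
  have HJE: "append_cols H J * E = J"
    unfolding E_def using append_cols_mult_append_rows[OF H J zero_carrier_mat one_carrier_mat] H J
    by simp
  show ?thesis
  proof (rule inj_onI)
    fix v w assume v: "v \<in> carrier_vec k" and w: "w \<in> carrier_vec k" and eq: "J *\<^sub>v v = J *\<^sub>v w"
    have "append_cols H J *\<^sub>v (E *\<^sub>v x) = J *\<^sub>v x" if "x \<in> carrier_vec k" for x
      using assoc_mult_mat_vec[of "append_cols H J" n "u + k" E k x] HJE H J E that by simp
    then have "append_cols H J *\<^sub>v (E *\<^sub>v v) = append_cols H J *\<^sub>v (E *\<^sub>v w)" using eq v w by simp
    then have "E *\<^sub>v v = E *\<^sub>v w"
      by (rule inj_onD[OF inj _ mult_mat_vec_carrier[OF E v] mult_mat_vec_carrier[OF E w]])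
    then show "v = w" using E_inj v w by (auto dest: inj_onD)
  qed
qed

lemma frob_sq_nonneg: "0 \<le> frob_sq A"
  unfolding frob_sq_def by (intro sum_nonneg) auto

lemma frob_sq_zero [simp]: "frob_sq (0\<^sub>m n m) = 0"
  unfolding frob_sq_def by simp

lemma frob_sq_eq_0_iff:
  assumes A: "A \<in> carrier_mat n m"
  shows "frob_sq A = 0 \<longleftrightarrow> A = 0\<^sub>m n m"
proof
  assume "frob_sq A = 0"
  then have "\<forall>i<n. \<forall>j<m. (cmod (A $$ (i, j)))\<^sup>2 = 0"
    using A unfolding frob_sq_def by (simp add: sum_nonneg_eq_0_iff sum_nonneg)
  then show "A = 0\<^sub>m n m" using A by (intro eq_matI) auto
qed simp

lemma frob_sq_append_cols:
  assumes A: "A \<in> carrier_mat n a" and B: "B \<in> carrier_mat n b"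
  shows "frob_sq (append_cols A B) = frob_sq A + frob_sq B"
proof -
  have split: "(\<Sum>j<a + b. f j) = (\<Sum>j<a. f j) + (\<Sum>j<b. f (j + a))" for f :: "nat \<Rightarrow> real"
    using sum.atLeastLessThan_concat[of 0 a "a + b" f] sum.shift_bounds_nat_ivl[of f 0 a b]
    by (simp add: atLeast0LessThan add.commute)
  show ?thesis
    using A B unfolding frob_sq_def
    by (simp add: split sum.distrib append_cols_index[OF A B])
qed

section \<open>Adjoint and Moore--Penrose pseudoinverse\<close>

lemma mat_adjoint_dim [simp]:
  "dim_row (mat_adjoint A) = dim_col A" "dim_col (mat_adjoint A) = dim_row A"
  unfolding mat_adjoint_def by simp_all

lemma mat_adjoint_carrier [simp]: "A \<in> carrier_mat n m \<Longrightarrow> mat_adjoint A \<in> carrier_mat m n"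
  by (intro carrier_matI) auto

lemma mat_adjoint_index [simp]:
  "i < dim_col A \<Longrightarrow> j < dim_row A \<Longrightarrow> mat_adjoint A $$ (i, j) = cnj (A $$ (j, i))"
  unfolding mat_adjoint_def by (simp add: mat_of_rows_index)

lemma mat_adjoint_adjoint [simp]: "mat_adjoint (mat_adjoint A) = (A :: complex mat)"
  by (rule eq_matI) auto

lemma mat_adjoint_one [simp]: "mat_adjoint (1\<^sub>m n :: complex mat) = 1\<^sub>m n"
  by (rule eq_matI) auto

lemma mat_adjoint_mult:
  fixes A B :: "complex mat"
  assumes "A \<in> carrier_mat n m" "B \<in> carrier_mat m k"
  shows "mat_adjoint (A * B) = mat_adjoint B * mat_adjoint A"
  using assms
  by (intro eq_matI) (auto simp: scalar_prod_def mult.commute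
      intro!: sum.cong)

lemma mat_adjoint_minus:
  fixes A B :: "complex mat"
  assumes "A \<in> carrier_mat n m" "B \<in> carrier_mat n m"
  shows "mat_adjoint (A - B) = mat_adjoint A - mat_adjoint B"
  using assms by (intro eq_matI) auto

lemma mat_adjoint_mult_vec_cscalar_prod:
  fixes A :: "complex mat"
  assumes A: "A \<in> carrier_mat n m" and x: "x \<in> carrier_vec m" and y: "y \<in> carrier_vec n"
  shows "(mat_adjoint A *\<^sub>v y) \<bullet>c x = y \<bullet>c (A *\<^sub>v x)"
proof -
  have "(mat_adjoint A *\<^sub>v y) \<bullet>c x = (\<Sum>j<m. \<Sum>i<n. cnj (A $$ (i, j)) * y $ i * cnj (x $ j))"
    using A x y by (simp add: scalar_prod_def atLeast0LessThan sum_distrib_right)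
  also have "\<dots> = (\<Sum>i<n. \<Sum>j<m. y $ i * (cnj (A $$ (i, j)) * cnj (x $ j)))"
    by (subst sum.swap) (simp add: mult_ac)
  also have "\<dots> = y \<bullet>c (A *\<^sub>v x)"
    using A x y by (simp add: scalar_prod_def atLeast0LessThan sum_distrib_left)
  finally show ?thesis .
qed

lemma mat_adjoint_mult_self_kernel:
  fixes A :: "complex mat"
  assumes A: "A \<in> carrier_mat n m" and v: "v \<in> carrier_vec m"
    and z: "(mat_adjoint A * A) *\<^sub>v v = 0\<^sub>v m"
  shows "A *\<^sub>v v = 0\<^sub>v n"
proof -
  have "(A *\<^sub>v v) \<bullet>c (A *\<^sub>v v) = (mat_adjoint A *\<^sub>v (A *\<^sub>v v)) \<bullet>c v"
    using mat_adjoint_mult_vec_cscalar_prod[OF A v, of "A *\<^sub>v v"] A v by simp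
  also have "\<dots> = 0"
    using z A v by (simp add: assoc_mult_mat_vec[symmetric, of _ m n _ m])
  finally show ?thesis
    using conjugate_square_eq_0_vec[of "A *\<^sub>v v" n] A v by simp
qed

definition penrose_conditions :: "complex mat \<Rightarrow> complex mat \<Rightarrow> bool" where
  "penrose_conditions A X \<longleftrightarrow> X \<in> carrier_mat (dim_col A) (dim_row A) \<and>
     A * X * A = A \<and> X * A * X = X \<and>
     mat_adjoint (A * X) = A * X \<and> mat_adjoint (X * A) = X * A"

lemma penrose_conditionsD:
  assumes "penrose_conditions A X"
  shows "A \<in> carrier_mat (dim_row A) (dim_col A)" "X \<in> carrier_mat (dim_col A) (dim_row A)"
    "A * X * A = A" "X * A * X = X" "mat_adjoint (A * X) = A * X" "mat_adjoint (X * A) = X * A"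
  using assms unfolding penrose_conditions_def by auto

lemma penrose_conditions_mult_right_eq:
  assumes X: "penrose_conditions A X" and Y: "penrose_conditions A Y"
  shows "X * A = Y * A"
proof -
  note A = penrose_conditionsD(1)[OF X]
  note Xc = penrose_conditionsD(2)[OF X]
  note Yc = penrose_conditionsD(2)[OF Y]
  have AH: "mat_adjoint A \<in> carrier_mat (dim_col A) (dim_row A)" using A by simp
  have XH: "mat_adjoint X \<in> carrier_mat (dim_row A) (dim_col A)" using Xc by simp
  have XA: "mat_adjoint A * mat_adjoint X = X * A"
    using penrose_conditionsD(6)[OF X] mat_adjoint_mult[OF Xc A] by simp
  have "mat_adjoint A = mat_adjoint (A * (Y * A))"
    using penrose_conditionsD(3)[OF Y] assoc_mult_mat[OF A Yc A] by simp
  also have "\<dots> = Y * A * mat_adjoint A"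
    using mat_adjoint_mult[OF A mult_carrier_mat[OF Yc A]] penrose_conditionsD(6)[OF Y] by simp
  finally have "X * A = Y * A * mat_adjoint A * mat_adjoint X" using XA by simp
  also have "\<dots> = Y * (A * X * A)"
    using assoc_mult_mat[OF mult_carrier_mat[OF Yc A] AH XH] XA
      assoc_mult_mat[OF Yc A mult_carrier_mat[OF Xc A]] assoc_mult_mat[OF A Xc A] by simp
  finally show ?thesis using penrose_conditionsD(3)[OF X] by simp
qed

lemma penrose_conditions_mult_left_eq:
  assumes X: "penrose_conditions A X" and Y: "penrose_conditions A Y"
  shows "A * X = A * Y"
proof -
  note A = penrose_conditionsD(1)[OF X]
  note Xc = penrose_conditionsD(2)[OF X]
  note Yc = penrose_conditionsD(2)[OF Y]
  have AH: "mat_adjoint A \<in> carrier_mat (dim_col A) (dim_row A)" using A by simp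
  have XH: "mat_adjoint X \<in> carrier_mat (dim_row A) (dim_col A)" using Xc by simp
  have AX: "mat_adjoint X * mat_adjoint A = A * X"
    using penrose_conditionsD(5)[OF X] mat_adjoint_mult[OF A Xc] by simp
  have "mat_adjoint A = mat_adjoint (A * Y * A)" using penrose_conditionsD(3)[OF Y] by simp
  also have "\<dots> = mat_adjoint A * (A * Y)"
    using mat_adjoint_mult[OF mult_carrier_mat[OF A Yc] A] penrose_conditionsD(5)[OF Y] by simp
  finally have "A * X = mat_adjoint X * (mat_adjoint A * (A * Y))" using AX by simp
  also have "\<dots> = A * X * A * Y"
    using assoc_mult_mat[OF XH AH mult_carrier_mat[OF A Yc]] AX
      assoc_mult_mat[OF mult_carrier_mat[OF A Xc] A Yc] by simp
  finally show ?thesis using penrose_conditionsD(3)[OF X] by simp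
qed

lemma penrose_conditions_unique:
  assumes X: "penrose_conditions A X" and Y: "penrose_conditions A Y"
  shows "X = Y"
proof -
  note A = penrose_conditionsD(1)[OF X]
  note Xc = penrose_conditionsD(2)[OF X]
  note Yc = penrose_conditionsD(2)[OF Y]
  have "X = X * (A * X)" using penrose_conditionsD(4)[OF X] assoc_mult_mat[OF Xc A Xc] by simp
  also have "\<dots> = Y * A * Y"
    unfolding penrose_conditions_mult_left_eq[OF X Y]
    using assoc_mult_mat[OF Xc A Yc] penrose_conditions_mult_right_eq[OF X Y] by simp
  also have "\<dots> = Y" using penrose_conditionsD(4)[OF Y] .
  finally show ?thesis .
qed

lemma pinv_eqI: "penrose_conditions A X \<Longrightarrow> pinv A = X"
  unfolding pinv_def penrose_conditions_def[symmetric]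
  by (blast intro: penrose_conditions_unique)

lemma gram_mat_inverse:
  fixes A :: "complex mat"
  assumes A: "A \<in> carrier_mat n m"
    and inj: "inj_on ((*\<^sub>v) A) (carrier_vec m)"
  obtains N where "N \<in> carrier_mat m m" "N * (mat_adjoint A * A) = 1\<^sub>m m"
    "mat_adjoint A * A * N = 1\<^sub>m m" "mat_adjoint N = N"
proof -
  let ?G = "mat_adjoint A * A"
  have G: "?G \<in> carrier_mat m m" using mult_carrier_mat[OF mat_adjoint_carrier[OF A] A] .
  have GH: "mat_adjoint ?G = ?G" using mat_adjoint_mult[OF mat_adjoint_carrier[OF A]] A by simp
  obtain N where N: "N \<in> carrier_mat m m" and GN: "?G * N = 1\<^sub>m m" and NG: "N * ?G = 1\<^sub>m m"
    using inj_square_mat_invertible[OF G] mat_adjoint_mult_self_kernel[OF A] inj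
    unfolding inj_on_mult_mat_vec_iff[OF G] inj_on_mult_mat_vec_iff[OF A] by metis
  have "mat_adjoint N = mat_adjoint N * (?G * N)" using N GN by simp
  also have "\<dots> = mat_adjoint N * ?G * N"
    using assoc_mult_mat[OF mat_adjoint_carrier[OF N] G N] by simp
  also have "mat_adjoint N * ?G = 1\<^sub>m m" using mat_adjoint_mult[OF G N] GH GN by simp
  also have "1\<^sub>m m * N = N" using N by simp
  finally show ?thesis using that N NG GN by blast
qed

lemma pinv_inj:
  fixes A :: "complex mat"
  assumes A: "A \<in> carrier_mat n m" and inj: "inj_on ((*\<^sub>v) A) (carrier_vec m)"
  shows "penrose_conditions A (pinv A)" "pinv A * A = 1\<^sub>m m"
proof -
  obtain N where N: "N \<in> carrier_mat m m" and NG: "N * (mat_adjoint A * A) = 1\<^sub>m m"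
    and NH: "mat_adjoint N = N"
    using gram_mat_inverse[OF A inj] by blast
  have AH: "mat_adjoint A \<in> carrier_mat m n" using A by simp
  define X where "X = N * mat_adjoint A"
  have X: "X \<in> carrier_mat m n" unfolding X_def using N AH by simp
  have XA: "X * A = 1\<^sub>m m" unfolding X_def using NG assoc_mult_mat[OF N AH A] by simp
  have "mat_adjoint (A * X) = A * X"
    unfolding X_def using mat_adjoint_mult[OF A mult_carrier_mat[OF N AH]]
      mat_adjoint_mult[OF N AH] NH A N by (simp add: assoc_mult_mat[of _ n m _ m _ n])
  moreover have "A * X * A = A" using XA A X by (simp add: assoc_mult_mat[of _ n m _ n _ m])
  ultimately have "penrose_conditions A X"
    unfolding penrose_conditions_def using X XA A by simp
  then show "penrose_conditions A (pinv A)" "pinv A * A = 1\<^sub>m m"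
    using pinv_eqI XA by simp_all
qed

lemma full_row_rank_imp_adjoint_inj:
  fixes S :: "complex mat"
  assumes S: "S \<in> carrier_mat m n" and r: "vec_space.rank m S = m"
  shows "inj_on ((*\<^sub>v) (mat_adjoint S)) (carrier_vec m)"
  unfolding inj_on_mult_mat_vec_iff[OF mat_adjoint_carrier[OF S]]
proof (intro ballI impI)
  fix w assume w: "w \<in> carrier_vec m" and z: "mat_adjoint S *\<^sub>v w = 0\<^sub>v n"
  define R where "R = mat_of_rows m [conjugate w]"
  have R: "R \<in> carrier_mat 1 m" unfolding R_def by (simp add: mat_of_rows_def)
  have row: "row R 0 = conjugate w" unfolding R_def using w by (intro eq_vecI) auto
  have "R * S = 0\<^sub>m 1 n"
  proof (rule eq_matI)
    fix i j assume "i < dim_row (0\<^sub>m 1 n :: complex mat)" "j < dim_col (0\<^sub>m 1 n :: complex mat)"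
    then have ij: "i = 0" "j < n" by auto
    have "(R * S) $$ (0, j) = conjugate w \<bullet> col S j" using R S ij row by simp
    also have "\<dots> = cnj ((mat_adjoint S *\<^sub>v w) $ j)"
      using S w ij by (simp add: scalar_prod_def mult.commute)
    also have "\<dots> = 0" using z ij by simp
    finally show "(R * S) $$ (i, j) = 0\<^sub>m 1 n $$ (i, j)" using ij by simp
  qed (use R S in auto)
  then have "vec_space.rank 1 R = 0" using rank_mult_eq_zero[OF R S] r by simp
  then have "R = 0\<^sub>m 1 m" using rank_pos[OF R] by linarith
  then have "conjugate w = 0\<^sub>v m" using row by auto
  then show "w = 0\<^sub>v m" by simp
qed

lemma pinv_full_row_rank:
  fixes S :: "complex mat"
  assumes S: "S \<in> carrier_mat m n" and r: "vec_space.rank m S = m"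
  shows "pinv S \<in> carrier_mat n m" "S * pinv S = 1\<^sub>m m"
proof -
  have SH: "mat_adjoint S \<in> carrier_mat n m" using S by simp
  obtain N where N: "N \<in> carrier_mat m m" and GN: "S * mat_adjoint S * N = 1\<^sub>m m"
    and NH: "mat_adjoint N = N"
    using gram_mat_inverse[OF SH full_row_rank_imp_adjoint_inj[OF S r]] by auto
  define X where "X = mat_adjoint S * N"
  have X: "X \<in> carrier_mat n m" unfolding X_def using N SH by simp
  have SX: "S * X = 1\<^sub>m m" unfolding X_def using GN assoc_mult_mat[OF S SH N] by simp
  have "mat_adjoint (X * S) = X * S"
    unfolding X_def using mat_adjoint_mult[OF mult_carrier_mat[OF SH N] S]
      mat_adjoint_mult[OF SH N] NH S N by (simp add: assoc_mult_mat[of _ n m _ m _ n])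
  moreover have "X * S * X = X" using SX S X by (simp add: assoc_mult_mat[of _ n m _ n _ m])
  ultimately have "penrose_conditions S X"
    unfolding penrose_conditions_def using X SX S by simp
  then show "pinv S \<in> carrier_mat n m" "S * pinv S = 1\<^sub>m m"
    using pinv_eqI SX X by simp_all
qed

section \<open>Orthogonal projections annihilating a matrix\<close>

lemma orth_proj_complement:
  fixes J :: "complex mat"
  assumes J: "J \<in> carrier_mat n m" and inj: "inj_on ((*\<^sub>v) J) (carrier_vec m)"
  shows "1\<^sub>m n - J * pinv J \<in> orth_projs n (n - m)" "(1\<^sub>m n - J * pinv J) * J = 0\<^sub>m n m"
proof -
  define Z where "Z = pinv J"
  have Z: "Z \<in> carrier_mat m n" and JZJ: "J * Z * J = J" and JZH: "mat_adjoint (J * Z) = J * Z"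
    using pinv_inj(1)[OF J inj] J unfolding Z_def penrose_conditions_def by auto
  define Q where "Q = J * Z"
  define P0 where "P0 = 1\<^sub>m n - Q"
  have Q: "Q \<in> carrier_mat n n" unfolding Q_def using J Z by simp
  have P0: "P0 \<in> carrier_mat n n" unfolding P0_def using Q by (simp add: minus_carrier_mat)
  have P0J: "P0 * J = 0\<^sub>m n m"
    unfolding P0_def using minus_mult_distrib_mat[OF one_carrier_mat Q J] JZJ J unfolding Q_def
    by simp
  have "P0 * Q = 0\<^sub>m n n" unfolding Q_def using P0J Z assoc_mult_mat[OF P0 J Z] by simp
  then have P0P0: "P0 * P0 = P0"
    using mult_minus_distrib_mat[OF P0 one_carrier_mat Q] P0 unfolding P0_def[symmetric] by simp
  have P0H: "mat_adjoint P0 = P0"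
    unfolding P0_def Q_def using mat_adjoint_minus[OF one_carrier_mat, of "J * Z"] J Z JZH by simp
  have "vec_space.rank n J + vec_space.rank n P0 \<le> n" by (rule rank_mult_eq_zero[OF P0 J P0J])
  moreover have "vec_space.rank n J = m" using rank_eq_dim_col_iff_inj[OF J] inj by simp
  moreover have "n \<le> vec_space.rank n P0 + m"
  proof -
    have "P0 + Q = 1\<^sub>m n" unfolding P0_def using Q by (intro eq_matI) auto
    then have "n \<le> vec_space.rank n P0 + vec_space.rank n Q"
      using vec_space.rank_subadditive[OF P0 Q] rank_one_mat[where 'a = complex, of n] by simp
    moreover have "vec_space.rank n Q \<le> m"
      by (rule rank_le_of_cols_in_range[OF Q J])
        (use J Z col_mult2[OF J Z] in \<open>auto simp: Q_def\<close>)
    ultimately show ?thesis by simp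
  qed
  ultimately have "mrank P0 = n - m" unfolding mrank_def using P0 by simp
  then show "1\<^sub>m n - J * pinv J \<in> orth_projs n (n - m)" "(1\<^sub>m n - J * pinv J) * J = 0\<^sub>m n m"
    using P0 P0P0 P0H P0J unfolding orth_projs_def P0_def Q_def Z_def by auto
qed

lemma orth_proj_eq_complement:
  fixes P J :: "complex mat"
  assumes P: "P \<in> orth_projs n (n - m)" and J: "J \<in> carrier_mat n m" and mn: "m \<le> n"
    and inj: "inj_on ((*\<^sub>v) J) (carrier_vec m)" and PJ: "P * J = 0\<^sub>m n m"
  shows "P = 1\<^sub>m n - J * pinv J"
proof -
  have Pc: "P \<in> carrier_mat n n" and PP: "P * P = P" and PH: "mat_adjoint P = P"
    and rank: "vec_space.rank n P + m = n"
    using P mn unfolding orth_projs_def mrank_def by auto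
  define Z where "Z = pinv J"
  have Z: "Z \<in> carrier_mat m n" and JZJ: "J * Z * J = J" and JZH: "mat_adjoint (J * Z) = J * Z"
    using pinv_inj(1)[OF J inj] J unfolding Z_def penrose_conditions_def by auto
  define G where "G = 1\<^sub>m n - P"
  have G: "G \<in> carrier_mat n n" unfolding G_def using Pc by (simp add: minus_carrier_mat)
  have GH: "mat_adjoint G = G" unfolding G_def using mat_adjoint_minus[OF one_carrier_mat Pc] PH by simp
  have GJ: "G * J = J"
    unfolding G_def using minus_mult_distrib_mat[OF one_carrier_mat Pc J] PJ J by simp
  have PG: "P * G = 0\<^sub>m n n"
    unfolding G_def using mult_minus_distrib_mat[OF Pc one_carrier_mat Pc] PP Pc by simp
  \<comment> \<open>The columns of \<open>G\<close> lie in the kernel of \<open>P\<close>, the range of \<open>J\<close> by a dimension count.\<close>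
  have "\<exists>c \<in> carrier_vec m. col G j = J *\<^sub>v c" if j: "j < n" for j
  proof (rule mat_kernel_in_range_of_mult_zero[OF Pc J rank PJ inj])
    show "col G j \<in> mat_kernel P"
      using col_mult2[OF Pc G j] PG G j by (auto intro: mat_kernelI[OF Pc])
  qed
  then obtain W where W: "W \<in> carrier_mat m n" and GJW: "G = J * W"
    using mat_factor_through_range[OF G J] by blast
  have JZG: "J * Z * G = G"
    unfolding GJW using JZJ assoc_mult_mat[OF mult_carrier_mat[OF J Z] J W] by simp
  have "G = mat_adjoint (J * Z * G)" using JZG GH by simp
  also have "\<dots> = G * (J * Z)"
    using mat_adjoint_mult[OF mult_carrier_mat[OF J Z] G] GH JZH by simp
  also have "\<dots> = J * Z" using GJ assoc_mult_mat[OF G J Z] by simp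
  finally have "G = J * pinv J" unfolding Z_def .
  moreover have "P = 1\<^sub>m n - G" unfolding G_def using Pc by (intro eq_matI) auto
  ultimately show ?thesis by simp
qed

lemma mrank_le_if_orth_proj_annihilates:
  fixes P C M :: "complex mat"
  assumes P: "P \<in> orth_projs n (n - m)" and mn: "m \<le> n"
    and C: "C \<in> carrier_mat n k" and inj: "inj_on ((*\<^sub>v) C) (carrier_vec k)"
    and M: "M \<in> carrier_mat k d" and PCM: "P * (C * M) = 0\<^sub>m n d"
  shows "mrank M \<le> m"
proof -
  have Pc: "P \<in> carrier_mat n n" and "vec_space.rank n P = n - m"
    using P unfolding orth_projs_def mrank_def by auto
  then show ?thesis
    using rank_mult_eq_zero[OF Pc mult_carrier_mat[OF C M] PCM] rank_mult_inj_left[OF C M inj] mn M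
    unfolding mrank_def by simp
qed

section \<open>Eclipsing\<close>

lemma qpsk_uminus: "q \<in> qpsk \<Longrightarrow> - q \<in> qpsk"
proof -
  assume "q \<in> qpsk"
  then obtain a b where ab: "q = (complex_of_real a + \<i> * complex_of_real b) / complex_of_real (sqrt 2)"
    "a \<in> {-1, 1}" "b \<in> {-1, 1}" unfolding qpsk_def by blast
  have "- q = (complex_of_real (- a) + \<i> * complex_of_real (- b)) / complex_of_real (sqrt 2)"
    using ab(1) by (simp add: field_simps)
  moreover have "- a \<in> {-1, 1}" "- b \<in> {-1, 1}" using ab by auto
  ultimately show ?thesis unfolding qpsk_def by blast
qed

lemma qpsk_nonzero: "q \<in> qpsk \<Longrightarrow> q \<noteq> 0"
  unfolding qpsk_def by (auto simp: Re_divide_of_real dest: arg_cong[of _ _ Re])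

lemma qpsk_mats_flip_entry:
  assumes S: "S \<in> qpsk_mats U D" and U: "0 < U" and D: "0 < D"
  obtains St where "St \<in> qpsk_mats U D" "St \<noteq> S" "vec_space.rank U (S - St) \<le> 1"
proof -
  define s0 where "s0 = S $$ (0, 0)"
  have s0: "s0 \<in> qpsk" using S U D unfolding qpsk_mats_def s0_def by auto
  have Sc: "S \<in> carrier_mat U D" using S unfolding qpsk_mats_def by simp
  define \<Delta> where "\<Delta> = mat U D (\<lambda>(i, j). if i = 0 \<and> j = 0 then 2 * s0 else 0)"
  have \<Delta>: "\<Delta> \<in> carrier_mat U D" unfolding \<Delta>_def by simp
  have "S - \<Delta> \<in> qpsk_mats U D"
    using S qpsk_uminus[OF s0] unfolding qpsk_mats_def \<Delta>_def s0_def by (auto simp: minus_carrier_mat)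
  moreover have "(S - \<Delta>) $$ (0, 0) \<noteq> s0"
    using U D qpsk_nonzero[OF s0] unfolding \<Delta>_def s0_def by auto
  then have "S - \<Delta> \<noteq> S" unfolding s0_def by auto
  moreover have "S - (S - \<Delta>) = \<Delta>" using Sc \<Delta> by (intro eq_matI) auto
  moreover have "vec_space.rank U \<Delta> \<le> 1"
    by (rule vec_space.rank_le_1_product_entries[OF \<Delta>,
          of "\<lambda>i. if i = 0 then 1 else 0" "\<lambda>j. if j = 0 then 2 * s0 else 0"])
      (auto simp: \<Delta>_def)
  ultimately show ?thesis using that by simp
qed

lemma eclipsed_ce_if_left_annihilated:
  fixes R :: "complex mat"
  assumes U: "0 < U" and D: "0 < D" and S_D: "S_D \<in> qpsk_mats U D"
    and W_T: "W_T \<in> carrier_mat I T" and W_D: "W_D \<in> carrier_mat I D"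
    and Z: "pinv S_T \<in> carrier_mat T U"
    and R: "R \<in> carrier_mat r I" and R_nz: "R \<noteq> 0\<^sub>m r I"
    and RX: "R * (W_D - W_T * pinv S_T * S_D) = 0\<^sub>m r D"
  shows "eclipsed_ce U D I S_T S_D W_T W_D"
proof -
  define K where "K = W_T * pinv S_T"
  define X where "X = W_D - K * S_D"
  have K: "K \<in> carrier_mat I U" unfolding K_def using W_T Z by simp
  have SD: "S_D \<in> carrier_mat U D" using S_D unfolding qpsk_mats_def by simp
  have X: "X \<in> carrier_mat I D" unfolding X_def using W_D K SD by (simp add: minus_carrier_mat)
  have rank_X: "vec_space.rank I X + 1 \<le> I"
    using rank_mult_eq_zero[OF R X RX[folded K_def, folded X_def]] rank_pos[OF R R_nz] by simp
  obtain St where St: "St \<in> qpsk_mats U D" "St \<noteq> S_D" and rank_\<Delta>: "vec_space.rank U (S_D - St) \<le> 1"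
    using qpsk_mats_flip_entry[OF S_D U D] by blast
  have Stc: "St \<in> carrier_mat U D" using St unfolding qpsk_mats_def by simp
  have "W_D - K * St = K * (S_D - St) + X"
    unfolding X_def using mult_minus_distrib_mat[OF K SD Stc] W_D K SD Stc by (intro eq_matI) auto
  then have "mrank ((S_D - St) @\<^sub>r (W_D - K * St)) \<le> I"
    unfolding mrank_def using rank_append_rows_mult_add_le[OF minus_carrier_mat[OF Stc, of S_D] K X]
      rank_\<Delta> rank_X Stc X by simp
  then show ?thesis unfolding eclipsed_ce_def K_def using St by blast
qed

section \<open>The joint estimation problem without noise\<close>

lemma jml_cost_split:
  assumes P: "P \<in> carrier_mat B B" and Y_T: "Y_T \<in> carrier_mat B T" and Y_D: "Y_D \<in> carrier_mat B D"
    and Ht: "Ht \<in> carrier_mat B U" and S_T: "S_T \<in> carrier_mat U T" and St: "St \<in> carrier_mat U D"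
  shows "jml_cost Y_T Y_D S_T P Ht St = frob_sq (P * (Y_T - Ht * S_T)) + frob_sq (P * (Y_D - Ht * St))"
proof -
  have "append_cols Y_T Y_D - Ht * append_cols S_T St = append_cols (Y_T - Ht * S_T) (Y_D - Ht * St)"
    using mult_append_cols[OF Ht S_T St] append_cols_minus[OF Y_T Y_D] Ht S_T St by simp
  moreover have "P * append_cols (Y_T - Ht * S_T) (Y_D - Ht * St) =
      append_cols (P * (Y_T - Ht * S_T)) (P * (Y_D - Ht * St))"
    using Y_T Y_D Ht S_T St by (intro mult_append_cols[OF P]) (auto simp: minus_carrier_mat)
  ultimately show ?thesis
    unfolding jml_cost_def using P Y_T Y_D Ht S_T St
    by (simp add: frob_sq_append_cols[of _ B T _ D] minus_carrier_mat)
qed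

lemma jml_cost_eq_0_iff:
  assumes P: "P \<in> carrier_mat B B" and Y_T: "Y_T \<in> carrier_mat B T" and Y_D: "Y_D \<in> carrier_mat B D"
    and Ht: "Ht \<in> carrier_mat B U" and S_T: "S_T \<in> carrier_mat U T" and St: "St \<in> carrier_mat U D"
  shows "jml_cost Y_T Y_D S_T P Ht St = 0 \<longleftrightarrow>
    P * (Y_T - Ht * S_T) = 0\<^sub>m B T \<and> P * (Y_D - Ht * St) = 0\<^sub>m B D"
proof -
  have "P * (Y_T - Ht * S_T) \<in> carrier_mat B T" "P * (Y_D - Ht * St) \<in> carrier_mat B D"
    using P Y_T Y_D Ht S_T St by (auto simp: minus_carrier_mat)
  then show ?thesis
    unfolding jml_cost_split[OF P Y_T Y_D Ht S_T St]
    by (simp add: add_nonneg_eq_0_iff frob_sq_nonneg frob_sq_eq_0_iff)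
qed

lemma jml_cost_nonneg: "0 \<le> jml_cost Y_T Y_D S_T P Ht St"
  unfolding jml_cost_def by (rule frob_sq_nonneg)

lemma is_jml_minimizer_iff_zero_cost:
  assumes P0: "P0 \<in> orth_projs B (B - I)" and H0: "H0 \<in> carrier_mat B U" and S0: "S0 \<in> qpsk_mats U D"
    and cost0: "jml_cost Y_T Y_D S_T P0 H0 S0 = 0"
  shows "is_jml_minimizer B U I D Y_T Y_D S_T P Ht St \<longleftrightarrow>
    P \<in> orth_projs B (B - I) \<and> Ht \<in> carrier_mat B U \<and> St \<in> qpsk_mats U D \<and>
    jml_cost Y_T Y_D S_T P Ht St = 0"
  unfolding is_jml_minimizer_def using jml_cost_nonneg cost0 P0 H0 S0 by (metis order_antisym)

lemma zero_cost_at_true_parameters: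
  fixes H J S_T S_D W_T W_D :: "complex mat"
  assumes H: "H \<in> carrier_mat B U" and J: "J \<in> carrier_mat B I"
    and J_inj: "inj_on ((*\<^sub>v) J) (carrier_vec I)"
    and S_T: "S_T \<in> carrier_mat U T" and S_D: "S_D \<in> carrier_mat U D"
    and W_T: "W_T \<in> carrier_mat I T" and W_D: "W_D \<in> carrier_mat I D"
  shows "jml_cost (H * S_T + J * W_T) (H * S_D + J * W_D) S_T (1\<^sub>m B - J * pinv J) H S_D = 0"
proof -
  define P where "P = 1\<^sub>m B - J * pinv J"
  have P: "P \<in> carrier_mat B B" and PJ: "P * J = 0\<^sub>m B I"
    using orth_proj_complement[OF J J_inj] unfolding P_def orth_projs_def by auto
  have "P * (H * S + J * W - H * S) = 0\<^sub>m B d"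
    if S: "S \<in> carrier_mat U d" and W: "W \<in> carrier_mat I d" for S W d
  proof -
    have "H * S + J * W - H * S = J * W" using H J S W by (intro eq_matI) auto
    moreover have "P * (J * W) = P * J * W" by (rule assoc_mult_mat[symmetric, OF P J W])
    ultimately show ?thesis using PJ W by simp
  qed
  then show ?thesis
    unfolding P_def[symmetric] using jml_cost_eq_0_iff[OF P _ _ H S_T S_D] H J S_T S_D W_T W_D by simp
qed

lemma training_fit_proj_channel:
  fixes P H Ht J S_T W_T Z :: "complex mat"
  assumes P: "P \<in> carrier_mat B B" and H: "H \<in> carrier_mat B U" and Ht: "Ht \<in> carrier_mat B U"
    and J: "J \<in> carrier_mat B I" and S_T: "S_T \<in> carrier_mat U T" and W_T: "W_T \<in> carrier_mat I T"
    and Z: "Z \<in> carrier_mat T U" and S_T_Z: "S_T * Z = 1\<^sub>m U"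
    and fit: "P * (H * S_T + J * W_T - Ht * S_T) = 0\<^sub>m B T"
  shows "P * Ht = P * H + P * J * (W_T * Z)"
proof -
  let ?Y = "H * S_T + J * W_T"
  have Y: "?Y \<in> carrier_mat B T" using H S_T J W_T by simp
  have PY: "P * ?Y = P * (Ht * S_T)"
    using fit mult_minus_distrib_mat[OF P Y mult_carrier_mat[OF Ht S_T]] P Y Ht S_T
    by (simp add: mat_minus_eq_0_iff[of _ B T])
  have "P * Ht = P * (Ht * S_T) * Z"
    using assoc_mult_mat[OF P mult_carrier_mat[OF Ht S_T] Z] assoc_mult_mat[OF Ht S_T Z] S_T_Z Ht
    by simp
  also have "\<dots> = P * (?Y * Z)" unfolding PY[symmetric] using P Y Z by simp
  also have "?Y * Z = H + J * (W_T * Z)"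
    using add_mult_distrib_mat[OF mult_carrier_mat[OF H S_T] mult_carrier_mat[OF J W_T] Z] S_T_Z H J W_T S_T Z
    by (simp add: assoc_mult_mat[of _ B U _ T _ U] assoc_mult_mat[of _ B I _ T _ U])
  also have "P * (H + J * (W_T * Z)) = P * H + P * J * (W_T * Z)"
    using mult_add_distrib_mat[OF P H mult_carrier_mat[OF J mult_carrier_mat[OF W_T Z]]] P J W_T Z
    by (simp add: assoc_mult_mat[of _ B B _ I _ U])
  finally show ?thesis .
qed

lemma data_fit_proj_annihilates:
  fixes P H Ht J S_D St W_D K :: "complex mat"
  assumes P: "P \<in> carrier_mat B B" and H: "H \<in> carrier_mat B U" and Ht: "Ht \<in> carrier_mat B U"
    and J: "J \<in> carrier_mat B I" and S_D: "S_D \<in> carrier_mat U D" and St: "St \<in> carrier_mat U D"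
    and W_D: "W_D \<in> carrier_mat I D" and K: "K \<in> carrier_mat I U"
    and PHt: "P * Ht = P * H + P * J * K"
    and fit: "P * (H * S_D + J * W_D - Ht * St) = 0\<^sub>m B D"
  shows "P * (append_cols H J * ((S_D - St) @\<^sub>r (W_D - K * St))) = 0\<^sub>m B D"
proof -
  let ?Y = "H * S_D + J * W_D" and ?E = "H * St + J * (K * St)"
  have Y: "?Y \<in> carrier_mat B D" and E: "?E \<in> carrier_mat B D" using H S_D J W_D St K by auto
  have "append_cols H J * ((S_D - St) @\<^sub>r (W_D - K * St)) = H * (S_D - St) + J * (W_D - K * St)"
    using St K W_D S_D by (intro append_cols_mult_append_rows[OF H J]) (auto simp: minus_carrier_mat)
  also have "\<dots> = ?Y - ?E"
    using mult_minus_distrib_mat[OF H S_D St] mult_minus_distrib_mat[OF J W_D mult_carrier_mat[OF K St]]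
      H J S_D St W_D K by (intro eq_matI) auto
  finally have M: "append_cols H J * ((S_D - St) @\<^sub>r (W_D - K * St)) = ?Y - ?E" .
  have "P * ?E = P * H * St + P * J * K * St"
    using mult_add_distrib_mat[OF P mult_carrier_mat[OF H St] mult_carrier_mat[OF J mult_carrier_mat[OF K St]]]
      P H J K St by (simp add: assoc_mult_mat[of _ B B _ U _ D] assoc_mult_mat[of _ B B _ I _ D]
        assoc_mult_mat[of _ B I _ U _ D])
  also have "\<dots> = (P * H + P * J * K) * St"
    using add_mult_distrib_mat[OF mult_carrier_mat[OF P H] mult_carrier_mat[OF mult_carrier_mat[OF P J] K] St]
    by simp
  also have "\<dots> = P * (Ht * St)" unfolding PHt[symmetric] using assoc_mult_mat[OF P Ht St] .
  finally have "P * ?E = P * (Ht * St)" .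
  then show ?thesis
    unfolding M using mult_minus_distrib_mat[OF P Y E] mult_minus_distrib_mat[OF P Y mult_carrier_mat[OF Ht St]]
      fit by simp
qed

lemma zero_cost_imp_recovery:
  fixes H J S_T S_D W_T W_D P Ht St :: "complex mat"
  assumes U: "0 < U" and D: "0 < D" and IB: "I \<le> B"
    and H: "H \<in> carrier_mat B U" and J: "J \<in> carrier_mat B I"
    and HJ_inj: "inj_on ((*\<^sub>v) (append_cols H J)) (carrier_vec (U + I))"
    and S_T: "S_T \<in> carrier_mat U T" and Z: "pinv S_T \<in> carrier_mat T U"
    and S_T_Z: "S_T * pinv S_T = 1\<^sub>m U"
    and S_D: "S_D \<in> qpsk_mats U D" and W_T: "W_T \<in> carrier_mat I T" and W_D: "W_D \<in> carrier_mat I D"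
    and not_eclipsed: "\<not> eclipsed_ce U D I S_T S_D W_T W_D"
    and P: "P \<in> orth_projs B (B - I)" and Ht: "Ht \<in> carrier_mat B U" and St: "St \<in> qpsk_mats U D"
    and cost: "jml_cost (H * S_T + J * W_T) (H * S_D + J * W_D) S_T P Ht St = 0"
  shows "P = 1\<^sub>m B - J * pinv J \<and> P * Ht = P * H \<and> St = S_D"
proof -
  have Pc: "P \<in> carrier_mat B B" using P unfolding orth_projs_def by simp
  have SDc: "S_D \<in> carrier_mat U D" and Stc: "St \<in> carrier_mat U D"
    using S_D St unfolding qpsk_mats_def by auto
  define K where "K = W_T * pinv S_T"
  have K: "K \<in> carrier_mat I U" unfolding K_def using W_T Z by simp
  have fit_T: "P * (H * S_T + J * W_T - Ht * S_T) = 0\<^sub>m B T"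
    and fit_D: "P * (H * S_D + J * W_D - Ht * St) = 0\<^sub>m B D"
    using cost jml_cost_eq_0_iff[OF Pc _ _ Ht S_T Stc] H J S_T SDc W_T W_D by simp_all
  have PHt: "P * Ht = P * H + P * J * K"
    unfolding K_def by (rule training_fit_proj_channel[OF Pc H Ht J S_T W_T Z S_T_Z fit_T])
  define M where "M = (S_D - St) @\<^sub>r (W_D - K * St)"
  have M: "M \<in> carrier_mat (U + I) D" unfolding M_def using SDc Stc W_D K by (auto simp: minus_carrier_mat)
  have HJ: "append_cols H J \<in> carrier_mat B (U + I)" using H J by simp
  have PHJM: "P * (append_cols H J * M) = 0\<^sub>m B D"
    unfolding M_def by (rule data_fit_proj_annihilates[OF Pc H Ht J SDc Stc W_D K PHt fit_D])
  have "mrank M \<le> I" by (rule mrank_le_if_orth_proj_annihilates[OF P IB HJ HJ_inj M PHJM])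
  then have St_eq: "St = S_D"
    using not_eclipsed St unfolding eclipsed_ce_def M_def K_def by auto
  define X where "X = W_D - W_T * pinv S_T * S_D"
  have X: "X \<in> carrier_mat I D" unfolding X_def using W_D W_T Z SDc by (simp add: minus_carrier_mat)
  have "append_cols H J * M = J * X"
    unfolding M_def St_eq X_def K_def
    using append_cols_mult_append_rows[OF H J zero_carrier_mat X[unfolded X_def]] H SDc
      mult_carrier_mat[OF J X[unfolded X_def]] by simp
  then have "P * J * X = 0\<^sub>m B D" using PHJM Pc J X by simp
  then have PJ: "P * J = 0\<^sub>m B I"
    using eclipsed_ce_if_left_annihilated[OF U D S_D W_T W_D Z mult_carrier_mat[OF Pc J]] not_eclipsed
    unfolding X_def by blast
  then show ?thesis
    using orth_proj_eq_complement[OF P J IB inj_on_append_cols_right[OF H J HJ_inj]] PHt St_eq Pc H K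
    by simp
qed

theorem theorem6:
  fixes B U I T D :: nat
    and H J S_T S_D W_T W_D N_T N_D Y_T Y_D :: "complex mat"
  assumes pos: "B > 0" "U > 0" "I > 0" "T > 0" "D > 0"
    and dimBUI: "B \<ge> U + I" and dimTU: "T \<ge> U"
    and H: "H \<in> carrier_mat B U" and J: "J \<in> carrier_mat B I"
    and HJ_rank: "mrank (append_cols H J) = U + I"
    and S_T: "S_T \<in> carrier_mat U T" and S_T_rank: "mrank S_T = U"
    and S_D: "S_D \<in> qpsk_mats U D"
    and W_T: "W_T \<in> carrier_mat I T" and W_D: "W_D \<in> carrier_mat I D"
    and N_T: "N_T = 0\<^sub>m B T" and N_D: "N_D = 0\<^sub>m B D"
    and Y_T: "Y_T = H * S_T + J * W_T + N_T"
    and Y_D: "Y_D = H * S_D + J * W_D + N_D"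
    and not_eclipsed: "\<not> eclipsed_ce U D I S_T S_D W_T W_D"
  shows "(\<exists>P Ht St. is_jml_minimizer B U I D Y_T Y_D S_T P Ht St) \<and>
         (\<forall>P Ht St. is_jml_minimizer B U I D Y_T Y_D S_T P Ht St \<longrightarrow>
            P = 1\<^sub>m B - J * pinv J \<and> P * Ht = P * H \<and> St = S_D)"
proof -
  have S_Dc: "S_D \<in> carrier_mat U D" using S_D unfolding qpsk_mats_def by simp
  have IB: "I \<le> B" using dimBUI by simp
  have Y: "Y_T = H * S_T + J * W_T" "Y_D = H * S_D + J * W_D"
    unfolding Y_T Y_D N_T N_D
    using add_carrier_mat[OF mult_carrier_mat[OF J W_T], of "H * S_T"]
      add_carrier_mat[OF mult_carrier_mat[OF J W_D], of "H * S_D"] by simp_all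
  have HJ_inj: "inj_on ((*\<^sub>v) (append_cols H J)) (carrier_vec (U + I))"
    using HJ_rank rank_eq_dim_col_iff_inj[OF append_cols_carrier[OF H J]] H unfolding mrank_def by simp
  note J_inj = inj_on_append_cols_right[OF H J HJ_inj]
  have "vec_space.rank U S_T = U" using S_T_rank S_T unfolding mrank_def by simp
  note S_T_pinv = pinv_full_row_rank[OF S_T this]
  note P0 = orth_proj_complement(1)[OF J J_inj]
  have cost0: "jml_cost Y_T Y_D S_T (1\<^sub>m B - J * pinv J) H S_D = 0"
    unfolding Y by (rule zero_cost_at_true_parameters[OF H J J_inj S_T S_Dc W_T W_D])
  note minimizer = is_jml_minimizer_iff_zero_cost[OF P0 H S_D cost0]
  have "P = 1\<^sub>m B - J * pinv J \<and> P * Ht = P * H \<and> St = S_D"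
    if "is_jml_minimizer B U I D Y_T Y_D S_T P Ht St" for P Ht St
  proof -
    have P: "P \<in> orth_projs B (B - I)" and Ht: "Ht \<in> carrier_mat B U" and St: "St \<in> qpsk_mats U D"
      and cost: "jml_cost Y_T Y_D S_T P Ht St = 0"
      using that unfolding minimizer by auto
    show ?thesis
      using cost unfolding Y
      by (rule zero_cost_imp_recovery[OF pos(2,5) IB H J HJ_inj S_T S_T_pinv S_D W_T W_D not_eclipsed P Ht St])
  qed
  then show ?thesis using minimizer P0 H S_D cost0 by blast
qed

end
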